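(* Let $(x_n)$ be a normalized, bimonotone, weakly null sequence in a real Banach space and $\xi<\omega_1$. Assume $(x_n)$ is an $\ell_1^{\xi}$ spreading model. Then there exists $M=(m_i)\in[\mathbb N]$ such that $(x_{m_i})$ is $S_\xi$ unconditional.
   Context: Bimonotone: for all finitely supported scalars $(a_i)$ and all $n$, $\max\{\|\sum_{i\le n}a_ix_i\|,\|\sum_{i>n}a_ix_i\|\}\le\|\sum_ia_ix_i\|$. For each countable ordinal $\xi$ fix successor ordinals $(\beta_n(\xi)+1)_n$: equal to $\xi$ if $\xi$ is a successor, strictly increasing to $\xi$ if $\xi$ is a limit. Schreier families: $S_0=\{\{n\}:n\in\mathbb N\}\cup\{\emptyset\}$; $S_{\zeta+1}=\{\bigcup_{i=1}^nF_i:n\le\min F_1,\ F_1<\cdots<F_n,\ F_i\in S_\zeta\}\cup\{\emptyset\}$ ($F<G$ means $\max F<\min G$); for limit $\xi$, $S_\xi=\{F:F\in S_{\beta_n(\xi)+1}\text{ for some }n\le\min F\}$. A semi-normalized $(y_i)$ is an $\ell_1^\xi$ spreading model if for some $c>0$, $\|\sum_{i\in F}a_iy_i\|\ge c\sum_{i\in F}|a_i|$ for all $F\in S_\xi$ and scalars. $(y_i)$ is $S_\xi$ unconditional if there is $C>0$ with $\|\sum_{i\in F}a_iy_i\|\le C\|\sum_{i=1}^\infty a_iy_i\|$ for every $F\in S_\xi$ and every finitely supported scalar sequence $(a_i)$. *)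

theory Defs
  imports "HOL-Analysis.Analysis"
begin

text \<open>Countable ordinals are modelled as elements of an arbitrary well-ordered type 'o;
  an element xi with countable initial segment represents a countable ordinal.
  Natural numbers of the paper are the positive naturals (index 0 is never used).\<close>

definition succ_ord :: "'o::wellorder \<Rightarrow> 'o" where
  "succ_ord g = (LEAST d. g < d)"

definition is_zero_ord :: "'o::wellorder \<Rightarrow> bool" where
  "is_zero_ord a \<longleftrightarrow> (\<forall>d. a \<le> d)"

definition is_succ_ord :: "'o::wellorder \<Rightarrow> bool" where
  "is_succ_ord a \<longleftrightarrow> (\<exists>g. g < a \<and> a = succ_ord g)"

definition is_limit_ord :: "'o::wellorder \<Rightarrow> bool" where
  "is_limit_ord a \<longleftrightarrow> \<not> is_zero_ord a \<and> \<not> is_succ_ord a"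

definition fundamental_choice :: "('o::wellorder \<Rightarrow> nat \<Rightarrow> 'o) \<Rightarrow> 'o \<Rightarrow> bool" where
  "fundamental_choice \<beta> xi \<longleftrightarrow>
     (\<forall>a \<le> xi.
        (is_succ_ord a \<longrightarrow> (\<forall>n\<ge>1. \<beta> a n < a \<and> succ_ord (\<beta> a n) = a)) \<and>
        (is_limit_ord a \<longrightarrow>
           (\<forall>n\<ge>1. \<beta> a n < a \<and> succ_ord (\<beta> a n) < succ_ord (\<beta> a (Suc n))) \<and>
           (\<forall>g<a. \<exists>n\<ge>1. g < succ_ord (\<beta> a n))))"

inductive schreier :: "('o::wellorder \<Rightarrow> nat \<Rightarrow> 'o) \<Rightarrow> 'o \<Rightarrow> nat set \<Rightarrow> bool"
  for \<beta> where
  empty: "schreier \<beta> a {}"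
| zero: "is_zero_ord a \<Longrightarrow> 1 \<le> n \<Longrightarrow> schreier \<beta> a {n}"
| succ: "g < a \<Longrightarrow> a = succ_ord g \<Longrightarrow> 1 \<le> k \<Longrightarrow>
         (\<forall>i<k. G i \<noteq> {} \<and> schreier \<beta> g (G i)) \<Longrightarrow>
         (\<forall>i. Suc i < k \<longrightarrow> Max (G i) < Min (G (Suc i))) \<Longrightarrow>
         k \<le> Min (G 0) \<Longrightarrow>
         schreier \<beta> a (\<Union>i<k. G i)"
| limit: "is_limit_ord a \<Longrightarrow> F \<noteq> {} \<Longrightarrow> 1 \<le> n \<Longrightarrow> n \<le> Min F \<Longrightarrow>
          schreier \<beta> (succ_ord (\<beta> a n)) F \<Longrightarrow> schreier \<beta> a F"

definition normalized_seq :: "(nat \<Rightarrow> 'a::real_normed_vector) \<Rightarrow> bool" where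
  "normalized_seq x \<longleftrightarrow> (\<forall>i\<ge>1. norm (x i) = 1)"

definition semi_normalized_seq :: "(nat \<Rightarrow> 'a::real_normed_vector) \<Rightarrow> bool" where
  "semi_normalized_seq x \<longleftrightarrow> (\<exists>c1 c2. 0 < c1 \<and> (\<forall>i\<ge>1. c1 \<le> norm (x i) \<and> norm (x i) \<le> c2))"

definition weakly_null :: "(nat \<Rightarrow> 'a::real_normed_vector) \<Rightarrow> bool" where
  "weakly_null x \<longleftrightarrow> (\<forall>f :: 'a \<Rightarrow> real. bounded_linear f \<longrightarrow> (\<lambda>n. f (x n)) \<longlonglongrightarrow> 0)"

text \<open>Finitely supported scalars: a i = 0 for i > K; the full sum is then over {1..K}.\<close>
definition bimonotone :: "(nat \<Rightarrow> 'a::real_normed_vector) \<Rightarrow> bool" where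
  "bimonotone x \<longleftrightarrow> (\<forall>(a :: nat \<Rightarrow> real) K n. (\<forall>i>K. a i = 0) \<longrightarrow>
      max (norm (\<Sum>i\<in>{1..n}. a i *\<^sub>R x i)) (norm (\<Sum>i\<in>{n<..K}. a i *\<^sub>R x i))
        \<le> norm (\<Sum>i\<in>{1..K}. a i *\<^sub>R x i))"

definition ell1_spreading_model :: "(nat set \<Rightarrow> bool) \<Rightarrow> (nat \<Rightarrow> 'a::real_normed_vector) \<Rightarrow> bool" where
  "ell1_spreading_model S y \<longleftrightarrow> semi_normalized_seq y \<and>
     (\<exists>c>0. \<forall>F (a :: nat \<Rightarrow> real). S F \<longrightarrow>
        c * (\<Sum>i\<in>F. \<bar>a i\<bar>) \<le> norm (\<Sum>i\<in>F. a i *\<^sub>R y i))"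

definition S_unconditional :: "(nat set \<Rightarrow> bool) \<Rightarrow> (nat \<Rightarrow> 'a::real_normed_vector) \<Rightarrow> bool" where
  "S_unconditional S y \<longleftrightarrow>
     (\<exists>C>0. \<forall>F (a :: nat \<Rightarrow> real) K. S F \<longrightarrow> (\<forall>i>K. a i = 0) \<longrightarrow>
        norm (\<Sum>i\<in>F. a i *\<^sub>R y i) \<le> C * norm (\<Sum>i\<in>{1..K}. a i *\<^sub>R y i))"

end

theory Submission
  imports Defs
begin

text \<open>
  On Schreier sets the norm is equivalent to the \<open>\<ell>\<^sub>1\<close> norm, so for \<open>F\<close> in \<open>S\<^sub>\<xi>\<close> and scalars \<open>a\<close> it
  suffices to bound \<open>\<Sum>\<bar>a i\<bar>\<close> over the part of \<open>F\<close> where \<open>a\<close> is positive. By Hahn--Banach some \<open>f\<close> in the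
  dual ball is \<open>\<ge> c\<close> on that part. The subsequence is chosen so that \<open>f\<close> can be replaced by a \<open>g\<close> in
  the dual ball that is still \<open>\<ge> c\<close> there and summably small on the rest of the subsequence; the
  small remainder is absorbed because bimonotonicity bounds each coefficient by the norm.

  The replacement works for every finite set (following Argyros, Mercourakis and Tsarpalias); the
  ordinal enters only through the spreading property of \<open>S\<^sub>\<xi>\<close>. Instead of infinite Ramsey
  theory, the subsequence is selected along a nonprincipal ultrafilter: if no selection were
  possible, the dual ball would contain functionals bounded away from 0 on arbitrarily long parts of a
  fixed infinite set, contradicting weak nullness by compactness.
\<close>

section \<open>Ultrafilters\<close>

text \<open>Zorn's lemma for the reversed order. It is applied below to proper filters and to
  sublinear maps, where ultrafilters and linear maps are the minimal elements.\<close>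

lemma Zorn_minimal:
  fixes A :: "'a::order set"
  assumes "A \<noteq> {}"
    and chain: "\<And>C. C \<subseteq> A \<Longrightarrow> C \<noteq> {} \<Longrightarrow> (\<And>x y. x \<in> C \<Longrightarrow> y \<in> C \<Longrightarrow> x \<le> y \<or> y \<le> x) \<Longrightarrow>
                 \<exists>u\<in>A. \<forall>x\<in>C. u \<le> x"
  shows "\<exists>m\<in>A. \<forall>a\<in>A. a \<le> m \<longrightarrow> a = m"
proof (rule predicate_Zorn[where P = "\<lambda>x y. y \<le> x"])
  show "partial_order_on A (relation_of (\<lambda>x y. y \<le> x) A)"
    by (rule partial_order_on_relation_ofI) auto
  fix C assume C: "C \<in> Chains (relation_of (\<lambda>x y. y \<le> x) A)"
  show "\<exists>u\<in>A. \<forall>a\<in>C. u \<le> a"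
  proof (cases "C = {}")
    case True
    with \<open>A \<noteq> {}\<close> show ?thesis by auto
  next
    case False
    show ?thesis
      by (rule chain) (use C False in \<open>auto simp: Chains_def relation_of_def\<close>)
  qed
qed

text \<open>Finer filters are smaller in the order, so an ultrafilter is a minimal proper
  filter.\<close>

lemma ultrafilter_exists:
  fixes G :: "'a filter"
  assumes "G \<noteq> bot"
  obtains U where "U \<noteq> bot" "U \<le> G" "\<And>P. eventually P U \<or> eventually (\<lambda>x. \<not> P x) U"
proof -
  let ?A = "{F. F \<noteq> bot \<and> F \<le> G}"
  have "\<exists>U\<in>?A. \<forall>F\<in>?A. F \<le> U \<longrightarrow> F = U"
  proof (rule Zorn_minimal)
    show "?A \<noteq> {}" using assms by auto
    fix C assume C: "C \<subseteq> ?A" "C \<noteq> {}" "\<And>x y. x \<in> C \<Longrightarrow> y \<in> C \<Longrightarrow> x \<le> y \<or> y \<le> x"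
    \<comment> \<open>A chain is directed, so its infimum could be improper only if some member
      were.\<close>
    have "eventually (\<lambda>_. False) (Inf C) \<longleftrightarrow> (\<exists>b\<in>C. eventually (\<lambda>_. False) b)"
    proof (rule eventually_Inf_base)
      fix F F' assume "F \<in> C" "F' \<in> C"
      then have "F \<le> F' \<or> F' \<le> F" by (rule C(3))
      with \<open>F \<in> C\<close> \<open>F' \<in> C\<close> show "\<exists>x\<in>C. x \<le> inf F F'"
        by (metis inf.absorb1 inf.absorb2 order_refl)
    qed (rule C(2))
    then have "Inf C \<noteq> bot"
      using C(1) by (auto simp: trivial_limit_def)
    moreover have "Inf C \<le> G"
      using C(1,2) by (auto intro: Inf_lower2)
    ultimately show "\<exists>u\<in>?A. \<forall>x\<in>C. u \<le> x"
      by (auto intro: Inf_lower)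
  qed
  then obtain U where U: "U \<noteq> bot" "U \<le> G"
    and least: "\<And>F. F \<noteq> bot \<Longrightarrow> F \<le> G \<Longrightarrow> F \<le> U \<Longrightarrow> F = U"
    by blast
  have ultra: "eventually P U \<or> eventually (\<lambda>x. \<not> P x) U" for P
  proof (cases "inf U (principal {x. P x}) = bot")
    case True
    then have "eventually (\<lambda>x. \<not> P x) U"
      by (simp add: trivial_limit_def eventually_inf_principal)
    then show ?thesis ..
  next
    \<comment> \<open>Here restricting \<open>U\<close> to \<open>P\<close> leaves a proper filter,
      which by minimality is \<open>U\<close> itself.\<close>
    case False
    then have "inf U (principal {x. P x}) = U"
      by (rule least[OF _ le_infI1[OF U(2)] inf_le1])
    then have "U \<le> principal {x. P x}"
      by (metis inf_le2)
    then show ?thesis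
      by (auto simp: le_principal)
  qed
  show ?thesis
    by (rule that[OF U ultra])
qed

text \<open>Compactness supplies a cluster point; an ultrafilter cannot avoid a neighbourhood of it,
  so it is a limit.\<close>

lemma ultrafilter_tendsto_compact:
  fixes f :: "'a \<Rightarrow> 'b::topological_space"
  assumes "compact S" "U \<noteq> bot" and ultra: "\<And>P. eventually P U \<or> eventually (\<lambda>x. \<not> P x) U"
    and ev: "eventually (\<lambda>x. f x \<in> S) U"
  obtains v where "v \<in> S" "(f \<longlongrightarrow> v) U"
proof -
  have "filtermap f U \<noteq> bot" "eventually (\<lambda>y. y \<in> S) (filtermap f U)"
    using assms by (simp_all add: filtermap_bot_iff eventually_filtermap)
  then obtain v where v: "v \<in> S" "inf (nhds v) (filtermap f U) \<noteq> bot"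
    using \<open>compact S\<close> unfolding compact_filter by blast
  have "(f \<longlongrightarrow> v) U"
  proof (rule topological_tendstoI)
    fix B assume "open B" "v \<in> B"
    show "eventually (\<lambda>x. f x \<in> B) U"
    proof (rule ccontr)
      assume "\<not> ?thesis"
      then have "eventually (\<lambda>y. y \<notin> B) (filtermap f U)"
        using ultra by (auto simp: eventually_filtermap)
      moreover have "eventually (\<lambda>y. y \<in> B) (nhds v)"
        using \<open>open B\<close> \<open>v \<in> B\<close> by (rule eventually_nhds_in_open)
      ultimately have "eventually (\<lambda>_. False) (inf (nhds v) (filtermap f U))"
        unfolding eventually_inf by blast
      with v(2) show False
        by (simp add: trivial_limit_def)
    qed
  qed
  with v(1) that show ?thesis by blast
qed

section \<open>Hahn--Banach\<close>

definition sublinear :: "('a::real_vector \<Rightarrow> real) \<Rightarrow> bool" where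
  "sublinear p \<longleftrightarrow> (\<forall>y z. p (y + z) \<le> p y + p z) \<and> (\<forall>t\<ge>0. \<forall>y. p (t *\<^sub>R y) = t * p y)"

text \<open>The reverse scaling inequality comes from applying \<open>scale\<close> with factor
  \<open>inverse t\<close> at \<open>t *\<^sub>R y\<close>.\<close>

lemma sublinearI:
  assumes add: "\<And>y z. p (y + z) \<le> p y + p z"
    and scale: "\<And>t y. t > 0 \<Longrightarrow> p (t *\<^sub>R y) \<le> t * p y"
    and zero: "p 0 \<le> 0"
  shows "sublinear p"
  unfolding sublinear_def
proof (intro conjI allI impI)
  fix t :: real and y assume "t \<ge> 0"
  have "p 0 = 0"
    using add[of 0 0] zero by simp
  show "p (t *\<^sub>R y) = t * p y"
  proof (cases "t = 0")
    case False
    with \<open>t \<ge> 0\<close> have "t > 0" by simp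
    then have "p (inverse t *\<^sub>R (t *\<^sub>R y)) \<le> inverse t * p (t *\<^sub>R y)"
      by (intro scale) simp
    with \<open>t > 0\<close> have "t * p y \<le> p (t *\<^sub>R y)"
      by (simp add: field_simps)
    with scale[OF \<open>t > 0\<close>, of y] show ?thesis by simp
  qed (simp add: \<open>p 0 = 0\<close>)
qed (rule add)

lemma sublinear_zero: "sublinear p \<Longrightarrow> p 0 = 0"
  unfolding sublinear_def by (metis order_refl mult_zero_left scaleR_zero_left)

lemma sublinear_minus:
  assumes "sublinear p"
  shows "- p (- y) \<le> p y"
proof -
  have "p (y + - y) \<le> p y + p (- y)"
    using assms unfolding sublinear_def by blast
  then show ?thesis
    using sublinear_zero[OF assms] by simp
qed

text \<open>Minimality in direction \<open>y\<close>: the infimum of \<open>q (z + t y) - t q y\<close> over \<open>t \<ge> 0\<close> is sublinear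
  and below \<open>q\<close>, so it equals \<open>q\<close>; at \<open>z = - y\<close>, \<open>t = 1\<close> this makes \<open>q\<close> odd.\<close>

lemma minimal_sublinear_linear:
  assumes q: "sublinear q" and min: "\<And>r. sublinear r \<Longrightarrow> r \<le> q \<Longrightarrow> r = q"
  shows "linear q"
proof -
  have add: "q (y + z) \<le> q y + q z" for y z
    using q by (simp add: sublinear_def)
  have scale: "t \<ge> 0 \<Longrightarrow> q (t *\<^sub>R y) = t * q y" for t y
    using q by (simp add: sublinear_def)
  have odd: "q (- y) = - q y" for y
  proof -
    define r where "r z = (INF t\<in>{0..}. q (z + t *\<^sub>R y) - t * q y)" for z
    have lower: "- q (- z) \<le> q (z + t *\<^sub>R y) - t * q y" if "t \<ge> 0" for z t
    proof -
      have "t * q y = q ((z + t *\<^sub>R y) + (- z))"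
        using that by (simp add: scale)
      also have "\<dots> \<le> q (z + t *\<^sub>R y) + q (- z)" by (rule add)
      finally show ?thesis by simp
    qed
    have bdd: "bdd_below ((\<lambda>t. q (z + t *\<^sub>R y) - t * q y) ` {0..})" for z
      using lower by (intro bdd_belowI[of _ "- q (- z)"]) auto
    have r_le: "r z \<le> q (z + t *\<^sub>R y) - t * q y" if "t \<ge> 0" for t z
      unfolding r_def using that by (intro cINF_lower bdd) auto
    have r_ge: "b \<le> r z" if "\<And>t. t \<ge> 0 \<Longrightarrow> b \<le> q (z + t *\<^sub>R y) - t * q y" for b z
      unfolding r_def using that by (intro cINF_greatest) auto
    have "sublinear r"
    proof (rule sublinearI)
      fix z w
      \<comment> \<open>Near-optimal parameters \<open>s\<close> for \<open>z\<close> and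
        \<open>t\<close> for \<open>w\<close> are combined into the parameter \<open>s + t\<close>
        for \<open>z + w\<close>.\<close>
      have "r (z + w) - (q (z + s *\<^sub>R y) - s * q y) \<le> q (w + t *\<^sub>R y) - t * q y"
        if "s \<ge> 0" "t \<ge> 0" for s t
      proof -
        have "r (z + w) \<le> q ((z + w) + (s + t) *\<^sub>R y) - (s + t) * q y"
          using that by (intro r_le) simp
        moreover have "q ((z + w) + (s + t) *\<^sub>R y) \<le> q (z + s *\<^sub>R y) + q (w + t *\<^sub>R y)"
          using add[of "z + s *\<^sub>R y" "w + t *\<^sub>R y"] by (simp add: algebra_simps)
        ultimately show ?thesis by (simp add: algebra_simps)
      qed
      then have "r (z + w) - (q (z + s *\<^sub>R y) - s * q y) \<le> r w" if "s \<ge> 0" for s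
        using that by (intro r_ge) auto
      then have "r (z + w) - r w \<le> r z"
        by (intro r_ge) (simp add: algebra_simps)
      then show "r (z + w) \<le> r z + r w" by simp
    next
      fix c :: real and z assume "c > 0"
      have "r (c *\<^sub>R z) / c \<le> q (z + t *\<^sub>R y) - t * q y" if "t \<ge> 0" for t
      proof -
        have "r (c *\<^sub>R z) \<le> q (c *\<^sub>R z + (c * t) *\<^sub>R y) - (c * t) * q y"
          using that \<open>c > 0\<close> by (intro r_le) simp
        also have "q (c *\<^sub>R z + (c * t) *\<^sub>R y) = c * q (z + t *\<^sub>R y)"
          using scale[of c "z + t *\<^sub>R y"] \<open>c > 0\<close> by (simp add: scaleR_add_right)
        finally show ?thesis
          using \<open>c > 0\<close> by (simp add: field_simps)
      qed
      then have "r (c *\<^sub>R z) / c \<le> r z"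
        by (rule r_ge)
      then show "r (c *\<^sub>R z) \<le> c * r z"
        using \<open>c > 0\<close> by (simp add: field_simps)
    next
      show "r 0 \<le> 0"
        using r_le[of 0 0] sublinear_zero[OF q] by simp
    qed
    moreover have "r \<le> q"
      using r_le[of 0] by (simp add: le_fun_def)
    ultimately have "r = q" by (rule min)
    then have "q (- y) \<le> q 0 - q y"
      using r_le[of 1 "- y"] by simp
    with sublinear_minus[OF q, of y] sublinear_zero[OF q] show ?thesis by simp
  qed
  show ?thesis
  proof (rule linearI)
    fix y z
    \<comment> \<open>With oddness this reads \<open>q y \<le> q (y + z) - q z\<close>, the missing
      half of additivity.\<close>
    have "q ((y + z) + (- z)) \<le> q (y + z) + q (- z)" by (rule add)
    with add[of y z] show "q (y + z) = q y + q z" by (simp add: odd)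
  next
    fix t :: real and y
    show "q (t *\<^sub>R y) = t *\<^sub>R q y"
    proof (cases "t \<ge> 0")
      case False
      then have "q ((- t) *\<^sub>R (- y)) = (- t) * q (- y)"
        by (intro scale) simp
      then show ?thesis by (simp add: odd)
    qed (simp add: scale)
  qed
qed

text \<open>Zorn yields a minimal sublinear map below \<open>p\<close>, and minimal ones are linear.
  The lower bound of a chain is its pointwise infimum.\<close>

theorem Hahn_Banach_sublinear:
  fixes p :: "'a::real_vector \<Rightarrow> real"
  assumes "sublinear p"
  obtains f where "linear f" "\<And>y. f y \<le> p y"
proof -
  let ?A = "{q. sublinear q \<and> q \<le> p}"
  have "\<exists>q\<in>?A. \<forall>r\<in>?A. r \<le> q \<longrightarrow> r = q"
  proof (rule Zorn_minimal)
    show "?A \<noteq> {}" using assms by auto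
    fix C :: "('a \<Rightarrow> real) set"
    assume C: "C \<subseteq> ?A" "C \<noteq> {}" "\<And>x y. x \<in> C \<Longrightarrow> y \<in> C \<Longrightarrow> x \<le> y \<or> y \<le> x"
    define u where "u z = (INF q\<in>C. q z)" for z
    \<comment> \<open>A bound independent of \<open>q\<close>, so the pointwise infimum is
      finite.\<close>
    have "- p (- z) \<le> q z" if "q \<in> C" for q z
    proof -
      have "sublinear q" "q (- z) \<le> p (- z)"
        using C(1) that by (auto simp: le_fun_def)
      with sublinear_minus[of q z] show ?thesis by linarith
    qed
    then have bdd: "bdd_below ((\<lambda>q. q z) ` C)" for z
      by (intro bdd_belowI[of _ "- p (- z)"]) auto
    have u_le: "u z \<le> q z" if "q \<in> C" for q z
      unfolding u_def using that by (intro cINF_lower bdd)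
    have u_ge: "b \<le> u z" if "\<And>q. q \<in> C \<Longrightarrow> b \<le> q z" for b z
      unfolding u_def using that C(2) by (intro cINF_greatest) auto
    have "sublinear u"
    proof (rule sublinearI)
      fix z w
      have "u (z + w) - q z \<le> r w" if "q \<in> C" "r \<in> C" for q r
      proof -
        have "q \<le> r \<or> r \<le> q"
          using that by (rule C(3))
        with that obtain s where s: "s \<in> C" "s \<le> q" "s \<le> r"
          by blast
        have "u (z + w) \<le> s (z + w)" using s(1) by (rule u_le)
        also have "\<dots> \<le> s z + s w" using s(1) C(1) by (auto simp: sublinear_def)
        also have "\<dots> \<le> q z + r w" using s(2,3) by (intro add_mono) (auto simp: le_fun_def)
        finally show ?thesis by simp
      qed
      then have "u (z + w) - q z \<le> u w" if "q \<in> C" for q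
        using that by (intro u_ge) auto
      then have "u (z + w) - u w \<le> u z"
        by (intro u_ge) (simp add: algebra_simps)
      then show "u (z + w) \<le> u z + u w" by simp
    next
      fix c :: real and z assume "c > 0"
      have "u (c *\<^sub>R z) / c \<le> q z" if "q \<in> C" for q
      proof -
        have "u (c *\<^sub>R z) \<le> q (c *\<^sub>R z)" using that by (rule u_le)
        also have "\<dots> = c * q z" using that C(1) \<open>c > 0\<close> by (auto simp: sublinear_def)
        finally show ?thesis using \<open>c > 0\<close> by (simp add: field_simps)
      qed
      then have "u (c *\<^sub>R z) / c \<le> u z"
        by (rule u_ge)
      then show "u (c *\<^sub>R z) \<le> c * u z"
        using \<open>c > 0\<close> by (simp add: field_simps)
    next
      obtain q where "q \<in> C" using C(2) by auto
      with u_le[of q 0] sublinear_zero[of q] C(1) show "u 0 \<le> 0" by auto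
    qed
    moreover have "u \<le> q" if "q \<in> C" for q
      using u_le[OF that] by (simp add: le_fun_def)
    moreover from this have "u \<le> p"
      using C(1,2) by (metis (mono_tags, lifting) all_not_in_conv mem_Collect_eq order_trans subsetD)
    ultimately show "\<exists>u\<in>?A. \<forall>x\<in>C. u \<le> x"
      by blast
  qed
  then obtain q where q: "sublinear q" "q \<le> p"
    and min: "\<And>r. sublinear r \<Longrightarrow> r \<le> p \<Longrightarrow> r \<le> q \<Longrightarrow> r = q"
    by blast
  have "linear q"
    using q(1)
  proof (rule minimal_sublinear_linear)
    show "r = q" if "sublinear r" "r \<le> q" for r
      using that(1) order_trans[OF that(2) q(2)] that(2) by (rule min)
  qed
  with q(2) that show ?thesis by (auto simp: le_fun_def)
qed

text \<open>The functional is dominated by the infimum of \<open>norm (y + v) - r\<close> over the cone.\<close>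

lemma functional_dominating_cone:
  fixes T :: "('a::real_normed_vector \<times> real) set"
  assumes zero: "(0, 0) \<in> T"
    and add: "\<And>v r w s. (v, r) \<in> T \<Longrightarrow> (w, s) \<in> T \<Longrightarrow> (v + w, r + s) \<in> T"
    and scale: "\<And>v r t. (v, r) \<in> T \<Longrightarrow> t > 0 \<Longrightarrow> (t *\<^sub>R v, t * r) \<in> T"
    and norm: "\<And>v r. (v, r) \<in> T \<Longrightarrow> r \<le> norm v"
  obtains f where "bounded_linear f" "\<And>y. \<bar>f y\<bar> \<le> norm y" "\<And>v r. (v, r) \<in> T \<Longrightarrow> r \<le> f v"
proof -
  define p where "p y = (INF z\<in>T. norm (y + fst z) - snd z)" for y
  \<comment> \<open>The hypothesis \<open>r \<le> norm v\<close> on the cone is what keeps the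
    infimum finite.\<close>
  have "- norm y \<le> norm (y + v) - r" if "(v, r) \<in> T" for y v r
    using norm[OF that] norm_triangle_ineq4[of "y + v" y] by simp
  then have bdd: "bdd_below ((\<lambda>z. norm (y + fst z) - snd z) ` T)" for y
    by (intro bdd_belowI[of _ "- norm y"]) auto
  have p_le: "p y \<le> norm (y + v) - r" if "(v, r) \<in> T" for y v r
    unfolding p_def using cINF_lower[OF bdd that] by simp
  have p_ge: "b \<le> p y" if "\<And>v r. (v, r) \<in> T \<Longrightarrow> b \<le> norm (y + v) - r" for b y
    unfolding p_def using that zero by (intro cINF_greatest) auto
  have "sublinear p"
  proof (rule sublinearI)
    fix y z
    have "p (y + z) - (norm (y + v) - r) \<le> norm (z + w) - s"
      if "(v, r) \<in> T" "(w, s) \<in> T" for v r w s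
    proof -
      have "p (y + z) \<le> norm ((y + z) + (v + w)) - (r + s)"
        using add[OF that] by (rule p_le)
      moreover have "norm ((y + z) + (v + w)) \<le> norm (y + v) + norm (z + w)"
        using norm_triangle_ineq[of "y + v" "z + w"] by (simp add: algebra_simps)
      ultimately show ?thesis by simp
    qed
    then have "p (y + z) - (norm (y + v) - r) \<le> p z" if "(v, r) \<in> T" for v r
      using that by (intro p_ge) auto
    then have "p (y + z) - p z \<le> p y"
      by (intro p_ge) (simp add: algebra_simps)
    then show "p (y + z) \<le> p y + p z" by simp
  next
    fix c :: real and y assume "c > 0"
    have "p (c *\<^sub>R y) / c \<le> norm (y + v) - r" if "(v, r) \<in> T" for v r
    proof -
      have "p (c *\<^sub>R y) \<le> norm (c *\<^sub>R y + c *\<^sub>R v) - c * r"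
        using scale[OF that \<open>c > 0\<close>] by (rule p_le)
      also have "norm (c *\<^sub>R y + c *\<^sub>R v) = c * norm (y + v)"
        using \<open>c > 0\<close> by (simp flip: scaleR_add_right)
      finally show ?thesis
        using \<open>c > 0\<close> by (simp add: field_simps)
    qed
    then have "p (c *\<^sub>R y) / c \<le> p y"
      by (rule p_ge)
    then show "p (c *\<^sub>R y) \<le> c * p y"
      using \<open>c > 0\<close> by (simp add: field_simps)
  next
    show "p 0 \<le> 0"
      using p_le[OF zero, of 0] by simp
  qed
  then obtain f where f: "linear f" "\<And>y. f y \<le> p y"
    using Hahn_Banach_sublinear by blast
  have le: "f y \<le> norm y" for y
    using f(2)[of y] p_le[OF zero, of y] by simp
  have bound: "\<bar>f y\<bar> \<le> norm y" for y
    using le[of y] le[of "- y"] linear_neg[OF f(1), of y] by simp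
  have "bounded_linear f"
    using f(1) bound by (intro bounded_linear_intro[of f 1]) (auto simp: linear_add linear_scale)
  \<comment> \<open>At \<open>- v\<close> the pair \<open>(v, r)\<close> itself gives
    \<open>p (- v) \<le> - r\<close>.\<close>
  moreover have "r \<le> f v" if "(v, r) \<in> T" for v r
    using f(2)[of "- v"] p_le[OF that, of "- v"] linear_neg[OF f(1), of v] by simp
  ultimately show ?thesis
    using bound that by blast
qed

section \<open>Making functionals small off a finite set\<close>

definition large_on :: "(nat \<Rightarrow> real) set \<Rightarrow> real \<Rightarrow> nat set \<Rightarrow> (nat \<Rightarrow> real) set" where
  "large_on Q \<delta> s = {f \<in> Q. \<forall>n\<in>s. \<delta> \<le> f n}"

text \<open>Allows the inductive predicate below to recurse under \<open>eventually\<close>.\<close>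

lemma eventually_mono_rule [mono]:
  "(\<And>x. P x \<longrightarrow> Q x) \<Longrightarrow> eventually P F \<longrightarrow> eventually Q F"
  by (auto elim: eventually_mono)

text \<open>A well-founded game along the filter \<open>U\<close>: \<open>forces \<delta> \<epsilon> U Q l s\<close> means that, extending \<open>s\<close> by
  \<open>U\<close>-many choices at each step, one reaches a set \<open>t\<close> such that some \<open>f\<close> in \<open>Q\<close> is \<open>\<ge> \<delta>\<close> on \<open>t\<close>
  and all such \<open>f\<close> exceed \<open>\<epsilon>\<close> at \<open>l\<close>.\<close>

inductive forces :: "real \<Rightarrow> real \<Rightarrow> nat filter \<Rightarrow> (nat \<Rightarrow> real) set \<Rightarrow> nat \<Rightarrow> nat set \<Rightarrow> bool"
  for \<delta> \<epsilon> U Q l where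
  base: "large_on Q \<delta> s \<noteq> {} \<Longrightarrow> (\<And>f. f \<in> large_on Q \<delta> s \<Longrightarrow> \<epsilon> < \<bar>f l\<bar>) \<Longrightarrow> forces \<delta> \<epsilon> U Q l s"
| step: "eventually (\<lambda>n. forces \<delta> \<epsilon> U Q l (insert n s)) U \<Longrightarrow> forces \<delta> \<epsilon> U Q l s"

lemma large_on_mono: "s \<subseteq> t \<Longrightarrow> large_on Q \<delta> t \<subseteq> large_on Q \<delta> s"
  by (auto simp: large_on_def)

lemma forces_large_on_nonempty:
  assumes "forces \<delta> \<epsilon> U Q l s" "U \<noteq> bot"
  shows "large_on Q \<delta> s \<noteq> {}"
  using assms
proof (induction rule: forces.induct)
  case (step s)
  then obtain n where "large_on Q \<delta> (insert n s) \<noteq> {}"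
    using eventually_happens'[OF \<open>U \<noteq> bot\<close> step.IH] by auto
  then show ?case
    using large_on_mono[of s "insert n s" Q \<delta>] by auto
qed

text \<open>The games for all \<open>l\<close> in \<open>J\<close> are played simultaneously:
  finitely many \<open>U\<close>-large sets of moves have a common move, and a coordinate once
  decided stays decided as the set grows. The outer induction is on \<open>J\<close>, the inner one
  on the game of a single \<open>l\<close>.\<close>

lemma forces_finite_common_extension:
  assumes "finite J" "U \<noteq> bot" "large_on Q \<delta> s \<noteq> {}"
    and "\<And>l. l \<in> J \<Longrightarrow> (\<forall>f\<in>large_on Q \<delta> s. \<epsilon> < \<bar>f l\<bar>) \<or> forces \<delta> \<epsilon> U Q l s"
  shows "\<exists>t. s \<subseteq> t \<and> large_on Q \<delta> t \<noteq> {} \<and> (\<forall>l\<in>J. \<forall>f\<in>large_on Q \<delta> t. \<epsilon> < \<bar>f l\<bar>)"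
  using assms(1,3,4)
proof (induction J arbitrary: s rule: finite_induct)
  case empty
  then show ?case by auto
next
  case (insert l J)
  define V where "V l s \<longleftrightarrow> (\<forall>f\<in>large_on Q \<delta> s. \<epsilon> < \<bar>f l\<bar>)" for l s
  have V_mono: "V l s \<Longrightarrow> s \<subseteq> t \<Longrightarrow> V l t" for l s t
    using large_on_mono[of s t Q \<delta>] by (auto simp: V_def)
  have IH: "\<exists>t. s \<subseteq> t \<and> large_on Q \<delta> t \<noteq> {} \<and> (\<forall>l\<in>J. V l t)"
    if "large_on Q \<delta> s \<noteq> {}" "\<And>l. l \<in> J \<Longrightarrow> V l s \<or> forces \<delta> \<epsilon> U Q l s" for s
    using insert.IH[of s] that unfolding V_def by blast
  have done_case: "\<exists>t. s \<subseteq> t \<and> large_on Q \<delta> t \<noteq> {} \<and> (\<forall>k\<in>insert l J. V k t)"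
    if "large_on Q \<delta> s \<noteq> {}" "V l s" "\<And>l. l \<in> J \<Longrightarrow> V l s \<or> forces \<delta> \<epsilon> U Q l s" for s
    using IH[OF that(1,3)] V_mono[OF that(2)] by auto
  have forced_case: "\<exists>t. s \<subseteq> t \<and> large_on Q \<delta> t \<noteq> {} \<and> (\<forall>k\<in>insert l J. V k t)"
    if "forces \<delta> \<epsilon> U Q l s" "\<And>l. l \<in> J \<Longrightarrow> V l s \<or> forces \<delta> \<epsilon> U Q l s" for s
    using that
  proof (induction rule: forces.induct)
    case (base s)
    then show ?case by (intro done_case) (auto simp: V_def)
  next
    case (step s)
    show ?case
    proof (cases "V l s")
      case True
      have "large_on Q \<delta> s \<noteq> {}"
        using step.IH by (intro forces_large_on_nonempty[OF forces.step \<open>U \<noteq> bot\<close>])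
          (auto elim: eventually_mono)
      then show ?thesis
        using True step.prems by (rule done_case)
    next
      case False
      \<comment> \<open>After \<open>U\<close>-almost every move of the game for \<open>l\<close>,
        every other coordinate is still decided or forced.\<close>
      have "eventually (\<lambda>n. V k (insert n s) \<or> forces \<delta> \<epsilon> U Q k (insert n s)) U" if "k \<in> J" for k
        using step.prems[OF that]
      proof
        assume "V k s"
        then have "V k (insert n s)" for n
          by (rule V_mono) auto
        then show ?thesis by simp
      next
        assume "forces \<delta> \<epsilon> U Q k s"
        then show ?thesis
        proof cases
          case base
          then have "V k s" by (simp add: V_def)
          then have "V k (insert n s)" for n
            by (rule V_mono) auto
          then show ?thesis by simp
        next
          case step
          then show ?thesis by (auto elim: eventually_mono)
        qed
      qed
      then have "eventually (\<lambda>n. \<forall>k\<in>J. V k (insert n s) \<or> forces \<delta> \<epsilon> U Q k (insert n s)) U"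
        using \<open>finite J\<close> by (simp add: eventually_ball_finite)
      from eventually_happens'[OF \<open>U \<noteq> bot\<close> eventually_conj[OF step.IH this]]
      obtain n t where "insert n s \<subseteq> t" "large_on Q \<delta> t \<noteq> {} \<and> (\<forall>k\<in>insert l J. V k t)"
        by blast
      then show ?thesis by (intro exI[of _ t]) auto
    qed
  qed
  have prem: "V k s \<or> forces \<delta> \<epsilon> U Q k s" if "k \<in> insert l J" for k
    using insert.prems(2)[OF that] by (simp add: V_def)
  have "\<exists>t. s \<subseteq> t \<and> large_on Q \<delta> t \<noteq> {} \<and> (\<forall>k\<in>insert l J. V k t)"
    using prem[OF insertI1]
  proof
    assume "V l s"
    with insert.prems(1) show ?thesis by (rule done_case) (rule prem, simp)
  next
    assume "forces \<delta> \<epsilon> U Q l s"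
    then show ?thesis by (rule forced_case) (rule prem, simp)
  qed
  then show ?case by (simp only: V_def)
qed

text \<open>Otherwise the forced \<open>l\<close> form an infinite set. A common extension for a
  finite subset \<open>J\<close> given by \<open>small\<close> yields an \<open>f\<close> in
  \<open>K\<close> exceeding \<epsilon> on all of \<open>J\<close>, a contradiction.\<close>

lemma eventually_not_forces_empty:
  assumes "U \<noteq> bot" "U \<le> sequentially"
    and ultra: "\<And>P. eventually P U \<or> eventually (\<lambda>x. \<not> P x) U"
    and "Q \<subseteq> K"
    and small: "\<And>L. infinite L \<Longrightarrow> \<exists>J\<subseteq>L. finite J \<and> (\<forall>f\<in>K. \<exists>l\<in>J. \<bar>f l\<bar> \<le> \<epsilon>)"
  shows "eventually (\<lambda>l. \<not> forces \<delta> \<epsilon> U Q l {}) U"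
proof (rule ccontr)
  assume not: "\<not> ?thesis"
  then have ev: "eventually (\<lambda>l. forces \<delta> \<epsilon> U Q l {}) U"
    using ultra by blast
  let ?L = "{l. forces \<delta> \<epsilon> U Q l {}}"
  have "infinite ?L"
  proof
    assume "finite ?L"
    then have "eventually (\<lambda>l. \<not> forces \<delta> \<epsilon> U Q l {}) sequentially"
      by (simp flip: cofinite_eq_sequentially add: eventually_cofinite)
    then have "eventually (\<lambda>l. \<not> forces \<delta> \<epsilon> U Q l {}) U"
      using \<open>U \<le> sequentially\<close> by (rule filter_leD[rotated])
    with not show False by blast
  qed
  from small[OF this] obtain J where J: "J \<subseteq> ?L" "finite J" "\<And>f. f \<in> K \<Longrightarrow> \<exists>l\<in>J. \<bar>f l\<bar> \<le> \<epsilon>"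
    by auto
  obtain l where "forces \<delta> \<epsilon> U Q l {}"
    using eventually_happens'[OF \<open>U \<noteq> bot\<close> ev] by blast
  then have "large_on Q \<delta> {} \<noteq> {}"
    using \<open>U \<noteq> bot\<close> by (rule forces_large_on_nonempty)
  then obtain t where "large_on Q \<delta> t \<noteq> {}" and t: "\<forall>l\<in>J. \<forall>f\<in>large_on Q \<delta> t. \<epsilon> < \<bar>f l\<bar>"
    using forces_finite_common_extension[OF J(2) \<open>U \<noteq> bot\<close>, of Q \<delta> "{}" \<epsilon>] J(1) by blast
  then obtain f where f: "f \<in> large_on Q \<delta> t" by blast
  then have "f \<in> K"
    using \<open>Q \<subseteq> K\<close> by (auto simp: large_on_def)
  from J(3)[OF this] t f show False by force
qed

text \<open>The terms are chosen so that no coordinate is ever forced to be large by the other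
  terms. Then a functional can be corrected one index at a time, in increasing order;
  \<open>N\<close> counts the indices treated.\<close>

theorem small_off_set_subsequence:
  fixes K :: "(nat \<Rightarrow> real) set" and \<epsilon> :: "nat \<Rightarrow> real"
  assumes small: "\<And>L e. infinite L \<Longrightarrow> 0 < e \<Longrightarrow> \<exists>J\<subseteq>L. finite J \<and> (\<forall>f\<in>K. \<exists>l\<in>J. \<bar>f l\<bar> \<le> e)"
    and \<epsilon>: "\<And>i. 0 < \<epsilon> i"
  obtains m :: "nat \<Rightarrow> nat" where "strict_mono m" "\<And>i. 1 \<le> m i"
    "\<And>F N f. finite F \<Longrightarrow> f \<in> K \<Longrightarrow> (\<And>i. i \<in> F \<Longrightarrow> \<delta> \<le> f (m i)) \<Longrightarrow>
       \<exists>g\<in>K. (\<forall>i\<in>F. \<delta> \<le> g (m i)) \<and> (\<forall>i<N. i \<notin> F \<longrightarrow> \<bar>g (m i)\<bar> \<le> \<epsilon> i)"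
proof -
  obtain U :: "nat filter" where U: "U \<noteq> bot" "U \<le> sequentially"
    and ultra: "\<And>P. eventually P U \<or> eventually (\<lambda>x. \<not> P x) U"
    using ultrafilter_exists[of sequentially] trivial_limit_sequentially by metis
  \<comment> \<open>Functionals with the indices below \<open>k\<close> already treated: large on
    \<open>A\<close>, small off it. Only the first \<open>k\<close> terms of \<open>m\<close>
    matter, as recursive choice requires.\<close>
  define Q where "Q m k A = {f\<in>K. (\<forall>i\<in>A. \<delta> \<le> f (m i)) \<and> (\<forall>i<k. i \<notin> A \<longrightarrow> \<bar>f (m i)\<bar> \<le> \<epsilon> i)}"
    for m :: "nat \<Rightarrow> nat" and k A
  have Q_cong: "Q m k A = Q m' k A" if "\<And>i. i < k \<Longrightarrow> m i = m' i" "A \<subseteq> {..<k}" for m m' k A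
    using that unfolding Q_def by (intro Collect_cong) (auto; metis lessThan_iff subsetD)
  have not_empty: "eventually (\<lambda>l. \<not> forces \<delta> (\<epsilon> k) U (Q m k A) l {}) U" for k m A
    using U ultra by (rule eventually_not_forces_empty[where K = K]) (use small \<epsilon> in \<open>auto simp: Q_def\<close>)
  \<comment> \<open>Admissibility of \<open>r\<close> as term \<open>n\<close>: it is not forced as
    a new coordinate, and adding it to a set of later terms forces no old coordinate
    \<open>m k\<close>.\<close>
  define P where "P m n r \<longleftrightarrow> 1 \<le> r \<and> (\<forall>i<n. m i < r) \<and>
      (\<forall>A\<subseteq>{..<n}. \<not> forces \<delta> (\<epsilon> n) U (Q m n A) r {}) \<and>
      (\<forall>k<n. \<forall>A\<subseteq>{..<k}. \<forall>s\<subseteq>{k<..<n}. \<not> forces \<delta> (\<epsilon> k) U (Q m k A) (m k) (insert r (m ` s)))"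
    for m :: "nat \<Rightarrow> nat" and n r
  \<comment> \<open>The largest index of \<open>s\<close> was chosen last, and its admissibility is
    exactly this claim; for empty \<open>s\<close> it is the admissibility of
    \<open>m k\<close>.\<close>
  have not_forces: "\<not> forces \<delta> (\<epsilon> k) U (Q m k A) (m k) (m ` s)"
    if P: "\<And>j. j < n \<Longrightarrow> P m j (m j)" and "k < n" "A \<subseteq> {..<k}" "s \<subseteq> {k<..<n}" for m n k A s
  proof (cases "s = {}")
    case True
    with P[OF \<open>k < n\<close>] \<open>A \<subseteq> {..<k}\<close> show ?thesis by (simp add: P_def)
  next
    case False
    have "finite s" using that(4) finite_subset by blast
    with False have Max: "Max s \<in> s" by simp
    then have j: "k < Max s" "Max s < n" using that(4) by auto
    have s': "s - {Max s} \<subseteq> {k<..<Max s}"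
      using that(4) \<open>finite s\<close> by (auto simp: less_le)
    have "insert (m (Max s)) (m ` (s - {Max s})) = m ` s"
      using Max by blast
    moreover have "\<not> forces \<delta> (\<epsilon> k) U (Q m k A) (m k) (insert (m (Max s)) (m ` (s - {Max s})))"
      using P[OF j(2)] j(1) \<open>A \<subseteq> {..<k}\<close> s' unfolding P_def by blast
    ultimately show ?thesis by simp
  qed
  have "\<exists>m. \<forall>n. P m n (m n)"
  proof (rule dependent_wellorder_choice)
    fix r :: nat and m m' :: "nat \<Rightarrow> nat" and n :: nat
    assume eq: "\<And>y. y < n \<Longrightarrow> m y = m' y"
    have Q: "Q m k A = Q m' k A" if "A \<subseteq> {..<k}" "k \<le> n" for k A
      using that by (intro Q_cong) (auto simp: eq)
    have im: "m ` s = m' ` s" if "s \<subseteq> {k<..<n}" for s k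
      using that eq by (intro image_cong) auto
    show "P m n r = P m' n r"
      unfolding P_def using eq by (auto simp: Q im)
  next
    fix n :: nat and m :: "nat \<Rightarrow> nat"
    assume P: "\<And>y. y < n \<Longrightarrow> P m y (m y)"
    \<comment> \<open>By \<open>step\<close>, the moves that force are not \<open>U\<close>-large,
      so by the ultrafilter property those that do not force are.\<close>
    have "eventually (\<lambda>r. \<not> forces \<delta> (\<epsilon> k) U (Q m k A) (m k) (insert r (m ` s))) U"
      if "k < n" "A \<subseteq> {..<k}" "s \<subseteq> {k<..<n}" for k A s
      using not_forces[OF P that] forces.step ultra by blast
    then have "eventually (\<lambda>r. \<forall>k\<in>{..<n}. \<forall>A\<in>Pow {..<k}. \<forall>s\<in>Pow {k<..<n}.
        \<not> forces \<delta> (\<epsilon> k) U (Q m k A) (m k) (insert r (m ` s))) U"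
      by (intro eventually_ball_finite ballI) auto
    moreover have "eventually (\<lambda>r. \<forall>A\<in>Pow {..<n}. \<not> forces \<delta> (\<epsilon> n) U (Q m n A) r {}) U"
      by (intro eventually_ball_finite ballI not_empty) auto
    moreover have "eventually (\<lambda>r. \<forall>i\<in>{..<n}. m i < r) U"
      by (intro eventually_ball_finite ballI filter_leD[OF U(2)] eventually_gt_at_top) auto
    moreover have "eventually (\<lambda>r. 1 \<le> r) U"
      by (intro filter_leD[OF U(2)] eventually_ge_at_top)
    ultimately have "eventually (\<lambda>r. P m n r) U"
      by eventually_elim (auto simp: P_def)
    then show "\<exists>r. P m n r"
      using eventually_happens'[OF U(1)] by blast
  qed
  then obtain m where m: "\<And>n. P m n (m n)" by blast
  show ?thesis
  proof (rule that)
    show "strict_mono m"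
      using m by (auto simp: P_def strict_mono_def)
    show "1 \<le> m i" for i
      using m by (auto simp: P_def)
    fix F N f
    assume "finite F" "f \<in> K" "\<And>i. i \<in> F \<Longrightarrow> \<delta> \<le> f (m i)"
    show "\<exists>g\<in>K. (\<forall>i\<in>F. \<delta> \<le> g (m i)) \<and> (\<forall>i<N. i \<notin> F \<longrightarrow> \<bar>g (m i)\<bar> \<le> \<epsilon> i)"
    proof (induction N)
      case 0
      show ?case using \<open>f \<in> K\<close> \<open>\<And>i. i \<in> F \<Longrightarrow> \<delta> \<le> f (m i)\<close> by auto
    next
      case (Suc N)
      then obtain g where g: "g \<in> K" "\<And>i. i \<in> F \<Longrightarrow> \<delta> \<le> g (m i)"
        "\<And>i. i < N \<Longrightarrow> i \<notin> F \<Longrightarrow> \<bar>g (m i)\<bar> \<le> \<epsilon> i"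
        by blast
      show ?case
      proof (cases "N \<in> F")
        case True
        with g show ?thesis by (auto simp: less_Suc_eq)
      next
        case False
        \<comment> \<open>\<open>A\<close> is the part of \<open>F\<close> before \<open>N\<close>,
          whose treatment is recorded in \<open>Q\<close>; \<open>s\<close> is the part after
          \<open>N\<close>, where largeness must be kept.\<close>
        define A where "A = F \<inter> {..<N}"
        define s where "s = F \<inter> {N<..}"
        obtain n where n: "F \<subseteq> {..<n}" "N < n"
          using \<open>finite F\<close> by (metis finite_nat_iff_bounded finite_insert insert_subset lessThan_iff)
        have A_iff: "i \<in> A \<longleftrightarrow> i \<in> F" if "i < N" for i
          using that by (auto simp: A_def)
        have F_cases: "i \<in> A \<or> i \<in> s" if "i \<in> F" for i
          using that False unfolding A_def s_def by (cases i N rule: linorder_cases) auto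
        have sub: "A \<subseteq> F" "s \<subseteq> F"
          by (auto simp: A_def s_def)
        have "\<not> forces \<delta> (\<epsilon> N) U (Q m N A) (m N) (m ` s)"
          using m n by (intro not_forces[of n]) (auto simp: A_def s_def)
        moreover have "g \<in> large_on (Q m N A) \<delta> (m ` s)"
          using g A_iff sub by (auto simp: large_on_def Q_def)
        \<comment> \<open>Since \<open>g\<close> makes the \<open>large_on\<close> set nonempty,
          failure of \<open>base\<close> leaves a member that is small at
          \<open>m N\<close>.\<close>
        ultimately obtain h where "h \<in> large_on (Q m N A) \<delta> (m ` s)" "\<bar>h (m N)\<bar> \<le> \<epsilon> N"
          using forces.base by (metis empty_iff not_less)
        then have "h \<in> K" "\<And>i. i \<in> A \<Longrightarrow> \<delta> \<le> h (m i)" "\<And>i. i \<in> s \<Longrightarrow> \<delta> \<le> h (m i)"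
          "\<And>i. i < Suc N \<Longrightarrow> i \<notin> A \<Longrightarrow> \<bar>h (m i)\<bar> \<le> \<epsilon> i"
          by (auto simp: large_on_def Q_def less_Suc_eq)
        then show ?thesis
          using F_cases sub by (intro bexI[of _ h]) blast+
      qed
    qed
  qed
qed

section \<open>Schreier families and bimonotone sequences\<close>

lemma schreier_finite_pos: "schreier \<beta> a F \<Longrightarrow> finite F \<and> 0 \<notin> F"
proof (induction rule: schreier.induct)
  case (succ g a k G)
  then show ?case by auto
qed auto

lemma strict_mono_Max_image:
  fixes m :: "nat \<Rightarrow> nat"
  shows "strict_mono m \<Longrightarrow> finite A \<Longrightarrow> A \<noteq> {} \<Longrightarrow> Max (m ` A) = m (Max A)"
  by (simp add: mono_Max_commute strict_mono_mono)

lemma strict_mono_Min_image: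
  fixes m :: "nat \<Rightarrow> nat"
  shows "strict_mono m \<Longrightarrow> finite A \<Longrightarrow> A \<noteq> {} \<Longrightarrow> Min (m ` A) = m (Min A)"
  by (simp add: mono_Min_commute strict_mono_mono)

text \<open>Since \<open>i \<le> m i\<close>, minima only grow, so the admissibility bounds survive;
  strict monotonicity keeps the blocks in order.\<close>

lemma schreier_spreading:
  assumes "schreier \<beta> a F" "strict_mono m"
  shows "schreier \<beta> a (m ` F)"
  using assms(1)
proof (induction rule: schreier.induct)
  case (zero a n)
  have "n \<le> m n" using assms(2) by (rule strict_mono_imp_increasing)
  with zero show ?case by (auto intro: schreier.zero)
next
  case (succ g a k G)
  have fin: "finite (G i)" if "i < k" for i
    using succ.IH that schreier_finite_pos by blast
  have "schreier \<beta> a (\<Union>i<k. m ` G i)"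
  proof (rule schreier.succ[OF succ.hyps(1-3)])
    show "\<forall>i<k. m ` G i \<noteq> {} \<and> schreier \<beta> g (m ` G i)"
      using succ.IH by blast
    show "\<forall>i. Suc i < k \<longrightarrow> Max (m ` G i) < Min (m ` G (Suc i))"
      using succ.IH succ.hyps fin assms(2)
      by (auto simp: strict_mono_Max_image strict_mono_Min_image strict_mono_less)
    have "k \<le> m (Min (G 0))"
      using succ.hyps strict_mono_imp_increasing[OF assms(2), of "Min (G 0)"] by linarith
    then show "k \<le> Min (m ` G 0)"
      using succ.IH succ.hyps fin assms(2) by (auto simp: strict_mono_Min_image)
  qed
  then show ?case by (simp add: image_UN)
next
  case (limit a F n)
  have "finite F" using limit.hyps schreier_finite_pos by blast
  moreover have "n \<le> m (Min F)"
    using limit.hyps strict_mono_imp_increasing[OF assms(2), of "Min F"] by linarith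
  ultimately have n: "n \<le> Min (m ` F)"
    using limit.hyps assms(2) by (simp add: strict_mono_Min_image)
  have "m ` F \<noteq> {}"
    using limit.hyps(2) by simp
  then show ?case
    by (rule schreier.limit[OF limit.hyps(1) _ limit.hyps(3) n limit.IH])
qed (simp add: schreier.empty)

text \<open>Bimonotonicity is applied to the coefficients extended by zero off
  \<open>A\<close>.\<close>

lemma bimonotone_sum_bound:
  assumes "bimonotone x" "finite A" "0 \<notin> A"
  shows "norm (\<Sum>i\<in>A \<inter> {..n}. a i *\<^sub>R x i) \<le> norm (\<Sum>i\<in>A. a i *\<^sub>R x i)"
    and "norm (\<Sum>i\<in>A \<inter> {n<..}. a i *\<^sub>R x i) \<le> norm (\<Sum>i\<in>A. a i *\<^sub>R x i)"
proof -
  obtain K where K: "A \<subseteq> {..<K}"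
    using \<open>finite A\<close> finite_nat_iff_bounded by blast
  define b where "b i = (if i \<in> A then a i else 0)" for i
  have b: "\<forall>i>K. b i = 0"
    using K by (auto simp: b_def)
  have eq: "(\<Sum>i\<in>B. b i *\<^sub>R x i) = (\<Sum>i\<in>A \<inter> B. a i *\<^sub>R x i)" if "finite B" for B
    unfolding b_def Int_commute[of A] sum.inter_restrict[OF that] by (intro sum.cong) auto
  have "1 \<le> i \<and> i \<le> K" if "i \<in> A" for i
    using that K \<open>0 \<notin> A\<close> by (cases i) auto
  then have "A \<inter> {1..n} = A \<inter> {..n}" "A \<inter> {n<..K} = A \<inter> {n<..}" "A \<inter> {1..K} = A"
    by auto
  moreover have "max (norm (\<Sum>i\<in>{1..n}. b i *\<^sub>R x i)) (norm (\<Sum>i\<in>{n<..K}. b i *\<^sub>R x i))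
      \<le> norm (\<Sum>i\<in>{1..K}. b i *\<^sub>R x i)"
    using assms(1) b unfolding bimonotone_def by blast
  ultimately show "norm (\<Sum>i\<in>A \<inter> {..n}. a i *\<^sub>R x i) \<le> norm (\<Sum>i\<in>A. a i *\<^sub>R x i)"
    and "norm (\<Sum>i\<in>A \<inter> {n<..}. a i *\<^sub>R x i) \<le> norm (\<Sum>i\<in>A. a i *\<^sub>R x i)"
    unfolding eq[OF finite_atLeastAtMost] eq[OF finite_greaterThanAtMost] by simp_all
qed

text \<open>Cutting to indices beyond \<open>j - 1\<close> and then up to \<open>j\<close> isolates
  one term of a normalized sequence.\<close>

lemma bimonotone_coeff_bound:
  assumes "bimonotone x" "normalized_seq x" "finite A" "0 \<notin> A" "j \<in> A"
  shows "\<bar>a j\<bar> \<le> norm (\<Sum>i\<in>A. a i *\<^sub>R x i)"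
proof -
  have "j \<ge> 1" using assms(4,5) by (cases j) auto
  then have j: "A \<inter> {j - 1<..} \<inter> {..j} = {j}" using assms(5) by auto
  have "\<bar>a j\<bar> = norm (\<Sum>i\<in>A \<inter> {j - 1<..} \<inter> {..j}. a i *\<^sub>R x i)"
    using assms(2) \<open>j \<ge> 1\<close> unfolding j by (simp add: normalized_seq_def)
  also have "\<dots> \<le> norm (\<Sum>i\<in>A \<inter> {j - 1<..}. a i *\<^sub>R x i)"
    using assms by (intro bimonotone_sum_bound) auto
  also have "\<dots> \<le> norm (\<Sum>i\<in>A. a i *\<^sub>R x i)"
    using assms by (intro bimonotone_sum_bound) auto
  finally show ?thesis .
qed

section \<open>Coordinates of the dual ball\<close>

text \<open>Coordinates \<open>(f (x i))\<^sub>i\<close> of the dual unit ball, described without functionals;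
  index 0 is never used and the coordinate there is normalized to 0.\<close>

definition dual_ball_coords :: "(nat \<Rightarrow> 'a::real_normed_vector) \<Rightarrow> (nat \<Rightarrow> real) set" where
  "dual_ball_coords x = {\<phi>. \<phi> 0 = 0 \<and> (\<forall>A a. finite A \<longrightarrow> 0 \<notin> A \<longrightarrow>
     \<bar>\<Sum>i\<in>A. a i * \<phi> i\<bar> \<le> norm (\<Sum>i\<in>A. a i *\<^sub>R x i))}"

lemma dual_ball_coordsD:
  "\<phi> \<in> dual_ball_coords x \<Longrightarrow> finite A \<Longrightarrow> 0 \<notin> A \<Longrightarrow>
    \<bar>\<Sum>i\<in>A. a i * \<phi> i\<bar> \<le> norm (\<Sum>i\<in>A. a i *\<^sub>R x i)"
  by (simp add: dual_ball_coords_def)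

lemma dual_ball_coords_of_functional:
  assumes "bounded_linear f" "\<And>y. \<bar>f y\<bar> \<le> norm y"
  shows "(\<lambda>i. if i = 0 then 0 else f (x i)) \<in> dual_ball_coords x"
proof -
  interpret f: bounded_linear f by fact
  have "(\<Sum>i\<in>A. a i * (if i = 0 then 0 else f (x i))) = f (\<Sum>i\<in>A. a i *\<^sub>R x i)"
    if "0 \<notin> A" for A a
    unfolding f.sum f.scale using that by (intro sum.cong) auto
  then show ?thesis
    using assms(2) by (simp add: dual_ball_coords_def)
qed

text \<open>By Hahn-Banach the coordinates come from a genuine bounded functional, to which weak
  nullness applies.\<close>

lemma dual_ball_coords_tendsto_zero:
  assumes "weakly_null x" "\<phi> \<in> dual_ball_coords x"
  shows "\<phi> \<longlonglongrightarrow> 0"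
proof -
  \<comment> \<open>The graph on the span of the functional sending \<open>x i\<close> to
    \<open>\<phi> i\<close>. It is closed under negation, so domination will give equality.\<close>
  define T where "T = {(\<Sum>i\<in>A. a i *\<^sub>R x i, \<Sum>i\<in>A. a i * \<phi> i) |A a. finite A \<and> 0 \<notin> A}"
  have T: "(\<Sum>i\<in>A. a i *\<^sub>R x i, \<Sum>i\<in>A. a i * \<phi> i) \<in> T" if "finite A" "0 \<notin> A" for A a
    using that unfolding T_def by blast
  obtain f where f: "bounded_linear f" "\<And>v r. (v, r) \<in> T \<Longrightarrow> r \<le> f v"
  proof (rule functional_dominating_cone[of T])
    show "(0, 0) \<in> T"
      using T[of "{}"] by simp
    fix v r assume "(v, r) \<in> T"
    then obtain A a where A: "finite A" "0 \<notin> A"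
      "v = (\<Sum>i\<in>A. a i *\<^sub>R x i)" "r = (\<Sum>i\<in>A. a i * \<phi> i)"
      unfolding T_def by blast
    show "r \<le> norm v"
      using dual_ball_coordsD[OF assms(2) A(1,2), of a] A(3,4) by simp
    show "(t *\<^sub>R v, t * r) \<in> T" for t :: real
      using T[OF A(1,2), of "\<lambda>i. t * a i"] A(3,4)
      by (simp add: scaleR_sum_right sum_distrib_left mult.assoc)
    fix w s assume "(w, s) \<in> T"
    then obtain B b where B: "finite B" "0 \<notin> B"
      "w = (\<Sum>i\<in>B. b i *\<^sub>R x i)" "s = (\<Sum>i\<in>B. b i * \<phi> i)"
      unfolding T_def by blast
    define c where "c i = (if i \<in> A then a i else 0) + (if i \<in> B then b i else 0)" for i
    have "v = (\<Sum>i\<in>A \<union> B. (if i \<in> A then a i else 0) *\<^sub>R x i)"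
      "r = (\<Sum>i\<in>A \<union> B. (if i \<in> A then a i else 0) * \<phi> i)"
      "w = (\<Sum>i\<in>A \<union> B. (if i \<in> B then b i else 0) *\<^sub>R x i)"
      "s = (\<Sum>i\<in>A \<union> B. (if i \<in> B then b i else 0) * \<phi> i)"
      unfolding A(3,4) B(3,4) using A(1) B(1)
      by (auto intro!: sum.mono_neutral_cong_left)
    then have "v + w = (\<Sum>i\<in>A \<union> B. c i *\<^sub>R x i)" "r + s = (\<Sum>i\<in>A \<union> B. c i * \<phi> i)"
      by (simp_all add: c_def scaleR_add_left distrib_right sum.distrib)
    then show "(v + w, r + s) \<in> T"
      using T[of "A \<union> B" c] A B by simp
  qed blast
  interpret f: bounded_linear f by fact
  have "f (x i) = \<phi> i" if "i \<ge> 1" for i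
  proof (rule antisym)
    show "\<phi> i \<le> f (x i)"
      using f(2)[OF T[of "{i}" "\<lambda>_. 1"]] that by simp
    show "f (x i) \<le> \<phi> i"
      using f(2)[OF T[of "{i}" "\<lambda>_. - 1"]] that by (simp add: f.neg)
  qed
  then have "eventually (\<lambda>i. f (x i) = \<phi> i) sequentially"
    by (auto simp: eventually_sequentially)
  moreover have "(\<lambda>i. f (x i)) \<longlonglongrightarrow> 0"
    using assms(1) f(1) by (auto simp: weakly_null_def)
  ultimately show ?thesis
    by (rule Lim_transform_eventually[rotated])
qed

text \<open>Truncation is dual to the initial-segment projection, a contraction by
  bimonotonicity.\<close>

lemma dual_ball_coords_truncate:
  assumes "bimonotone x" "\<phi> \<in> dual_ball_coords x"
  shows "(\<lambda>i. if i \<le> n then \<phi> i else 0) \<in> dual_ball_coords x"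
proof -
  have "\<bar>\<Sum>i\<in>A. a i * (if i \<le> n then \<phi> i else 0)\<bar> \<le> norm (\<Sum>i\<in>A. a i *\<^sub>R x i)"
    if A: "finite A" "0 \<notin> A" for A a
  proof -
    have "(\<Sum>i\<in>A. a i * (if i \<le> n then \<phi> i else 0)) = (\<Sum>i\<in>A \<inter> {..n}. a i * \<phi> i)"
      using A by (auto intro!: sum.mono_neutral_cong_right split: if_splits)
    also have "\<bar>\<dots>\<bar> \<le> norm (\<Sum>i\<in>A \<inter> {..n}. a i *\<^sub>R x i)"
      using A by (intro dual_ball_coordsD[OF assms(2)]) auto
    also have "\<dots> \<le> norm (\<Sum>i\<in>A. a i *\<^sub>R x i)"
      using assms(1) A by (rule bimonotone_sum_bound)
    finally show ?thesis .
  qed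
  then show ?thesis
    using assms(2) by (simp add: dual_ball_coords_def)
qed

lemma dual_ball_coords_abs_le_one:
  assumes "normalized_seq x" "\<phi> \<in> dual_ball_coords x"
  shows "\<bar>\<phi> i\<bar> \<le> 1"
  using dual_ball_coordsD[OF assms(2), of "{i}" "\<lambda>_. 1"] assms
  by (cases "i = 0") (auto simp: dual_ball_coords_def normalized_seq_def)

text \<open>Compactness: otherwise an ultrafilter limit of counterexamples would be a coordinate sequence
  that does not tend to 0.\<close>

lemma dual_ball_coords_small:
  assumes "weakly_null x" "normalized_seq x" "infinite L" "0 < e"
  shows "\<exists>J\<subseteq>L. finite J \<and> (\<forall>\<phi>\<in>dual_ball_coords x. \<exists>l\<in>J. \<bar>\<phi> l\<bar> \<le> e)"
proof (rule ccontr)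
  assume not: "\<not> ?thesis"
  \<comment> \<open>The finite sets \<open>L \<inter> {..k}\<close> exhaust \<open>L\<close>, so
    each fixed \<open>l\<close> in \<open>L\<close> is eventually covered.\<close>
  have "\<exists>\<phi>. \<phi> \<in> dual_ball_coords x \<and> (\<forall>l\<in>L \<inter> {..k}. e < \<bar>\<phi> l\<bar>)" for k
  proof -
    have "L \<inter> {..k} \<subseteq> L" "finite (L \<inter> {..k})" by auto
    with not have "\<not> (\<forall>\<phi>\<in>dual_ball_coords x. \<exists>l\<in>L \<inter> {..k}. \<bar>\<phi> l\<bar> \<le> e)"
      by blast
    then show ?thesis by (simp only: bex_simps ball_simps not_le) blast
  qed
  then have "\<exists>\<Phi>. \<forall>k. \<Phi> k \<in> dual_ball_coords x \<and> (\<forall>l\<in>L \<inter> {..k}. e < \<bar>\<Phi> k l\<bar>)"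
    by (intro choice allI)
  then obtain \<Phi> where \<Phi>: "\<And>k. \<Phi> k \<in> dual_ball_coords x" "\<And>k l. l \<in> L \<Longrightarrow> l \<le> k \<Longrightarrow> e < \<bar>\<Phi> k l\<bar>"
    by auto
  obtain U :: "nat filter" where U: "U \<noteq> bot" "U \<le> sequentially"
    and ultra: "\<And>P. eventually P U \<or> eventually (\<lambda>x. \<not> P x) U"
    using ultrafilter_exists[of sequentially] trivial_limit_sequentially by metis
  have "\<exists>v. ((\<lambda>k. \<Phi> k i) \<longlongrightarrow> v) U" for i
  proof (rule ultrafilter_tendsto_compact[of "{- 1..1 :: real}" U "\<lambda>k. \<Phi> k i"])
    show "eventually (\<lambda>k. \<Phi> k i \<in> {- 1..1}) U"
      using dual_ball_coords_abs_le_one[OF assms(2) \<Phi>(1)] by (simp add: abs_le_iff minus_le_iff)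
  qed (use U ultra in blast)+
  then obtain \<phi> where \<phi>: "\<And>i. ((\<lambda>k. \<Phi> k i) \<longlongrightarrow> \<phi> i) U"
    by metis
  have "\<phi> \<in> dual_ball_coords x"
  proof -
    have "\<phi> 0 = 0"
      using tendsto_unique[OF U(1) \<phi>[of 0], of 0] \<Phi>(1) by (simp add: dual_ball_coords_def)
    \<comment> \<open>Each defining inequality involves finitely many coordinates, so it passes to
      the coordinatewise limit.\<close>
    moreover have "\<bar>\<Sum>i\<in>A. a i * \<phi> i\<bar> \<le> norm (\<Sum>i\<in>A. a i *\<^sub>R x i)" if "finite A" "0 \<notin> A" for A a
    proof (rule tendsto_upperbound)
      show "((\<lambda>k. \<bar>\<Sum>i\<in>A. a i * \<Phi> k i\<bar>) \<longlongrightarrow> \<bar>\<Sum>i\<in>A. a i * \<phi> i\<bar>) U"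
        by (intro tendsto_intros \<phi>)
      show "eventually (\<lambda>k. \<bar>\<Sum>i\<in>A. a i * \<Phi> k i\<bar> \<le> norm (\<Sum>i\<in>A. a i *\<^sub>R x i)) U"
        using dual_ball_coordsD[OF \<Phi>(1) that] by simp
    qed (rule U(1))
    ultimately show ?thesis
      by (simp add: dual_ball_coords_def)
  qed
  then have "\<phi> \<longlonglongrightarrow> 0"
    by (rule dual_ball_coords_tendsto_zero[OF assms(1)])
  then have "eventually (\<lambda>l. \<bar>\<phi> l\<bar> < e) sequentially"
    using \<open>0 < e\<close> by (auto simp: tendsto_iff)
  then obtain N where "\<And>l. N \<le> l \<Longrightarrow> \<bar>\<phi> l\<bar> < e"
    by (auto simp: eventually_sequentially)
  moreover obtain l where "N \<le> l" "l \<in> L"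
    using \<open>infinite L\<close> by (auto simp: infinite_nat_iff_unbounded_le)
  ultimately have l: "l \<in> L" "\<bar>\<phi> l\<bar> < e"
    by auto
  have "e \<le> \<bar>\<phi> l\<bar>"
  proof (rule tendsto_lowerbound)
    show "((\<lambda>k. \<bar>\<Phi> k l\<bar>) \<longlongrightarrow> \<bar>\<phi> l\<bar>) U"
      by (intro tendsto_intros \<phi>)
    have "eventually (\<lambda>k. l \<le> k) U"
      by (rule filter_leD[OF U(2)]) (rule eventually_ge_at_top)
    then show "eventually (\<lambda>k. e \<le> \<bar>\<Phi> k l\<bar>) U"
      by eventually_elim (use \<Phi>(2)[OF l(1)] in \<open>simp add: less_imp_le\<close>)
  qed (rule U(1))
  with l(2) show False by simp
qed

text \<open>The hypothesis on nonnegative combinations says that the cone of pairs \<open>T\<close>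
  lies below the norm. A dominating functional is then tested on single vectors.\<close>

lemma dual_ball_coords_positive:
  assumes A: "finite A" "0 \<notin> A"
    and ell1: "\<And>b. (\<And>i. 0 \<le> b i) \<Longrightarrow> c * (\<Sum>i\<in>A. b i) \<le> norm (\<Sum>i\<in>A. b i *\<^sub>R x i)"
  obtains \<phi> where "\<phi> \<in> dual_ball_coords x" "\<And>i. i \<in> A \<Longrightarrow> c \<le> \<phi> i"
proof -
  define T where "T = {(\<Sum>i\<in>A. b i *\<^sub>R x i, c * (\<Sum>i\<in>A. b i)) |b. \<forall>i. 0 \<le> b i}"
  have T: "(\<Sum>i\<in>A. b i *\<^sub>R x i, c * (\<Sum>i\<in>A. b i)) \<in> T" if "\<And>i. 0 \<le> b i" for b
    using that unfolding T_def by blast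
  obtain f where f: "bounded_linear f" "\<And>y. \<bar>f y\<bar> \<le> norm y" "\<And>v r. (v, r) \<in> T \<Longrightarrow> r \<le> f v"
  proof (rule functional_dominating_cone[of T])
    show "(0, 0) \<in> T"
      using T[of "\<lambda>_. 0"] by simp
    fix v r assume "(v, r) \<in> T"
    then obtain b where b: "\<And>i. 0 \<le> b i" "v = (\<Sum>i\<in>A. b i *\<^sub>R x i)" "r = c * (\<Sum>i\<in>A. b i)"
      unfolding T_def by blast
    show "r \<le> norm v"
      using ell1[OF b(1)] b(2,3) by simp
    show "(t *\<^sub>R v, t * r) \<in> T" if "t > 0" for t :: real
      using T[of "\<lambda>i. t * b i"] b that
      by (simp add: scaleR_sum_right sum_distrib_left mult.left_commute)
    fix w s assume "(w, s) \<in> T"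
    then obtain d where d: "\<And>i. 0 \<le> d i" "w = (\<Sum>i\<in>A. d i *\<^sub>R x i)" "s = c * (\<Sum>i\<in>A. d i)"
      unfolding T_def by blast
    show "(v + w, r + s) \<in> T"
      using T[of "\<lambda>i. b i + d i"] b d
      by (simp add: scaleR_add_left sum.distrib distrib_left)
  qed blast
  have "c \<le> f (x i)" if "i \<in> A" for i
    using f(3)[OF T[of "\<lambda>j. if j = i then 1 else 0"]] that A
    by (simp add: if_distrib[of "\<lambda>c. c *\<^sub>R _"] cong: if_cong)
  with A(2) have "c \<le> (if i = 0 then 0 else f (x i))" if "i \<in> A" for i
    using that by auto
  with dual_ball_coords_of_functional[OF f(1,2)] show ?thesis
    by (rule that)
qed

section \<open>Passing to the subsequence and the final estimate\<close>

lemma sum_image_the_inv: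
  assumes "inj m"
  shows "(\<Sum>i\<in>m ` A. h (the_inv m i) i) = (\<Sum>i\<in>A. h i (m i))"
  using assms by (subst sum.reindex) (auto simp: the_inv_f_f intro: inj_on_subset)

theorem theorem1p10:
  fixes x :: "nat \<Rightarrow> 'a::banach"
    and xi :: "'o::wellorder"
    and \<beta> :: "'o \<Rightarrow> nat \<Rightarrow> 'o"
  assumes "countable {d. d < xi}"
    and "fundamental_choice \<beta> xi"
    and "normalized_seq x"
    and "bimonotone x"
    and "weakly_null x"
    and "ell1_spreading_model (schreier \<beta> xi) x"
  shows "\<exists>m :: nat \<Rightarrow> nat. strict_mono m \<and> (\<forall>i\<ge>1. 1 \<le> m i) \<and>
           S_unconditional (schreier \<beta> xi) (x \<circ> m)"
proof -
  obtain c where c: "c > 0"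
    and ell1: "\<And>F a. schreier \<beta> xi F \<Longrightarrow> c * (\<Sum>i\<in>F. \<bar>a i\<bar>) \<le> norm (\<Sum>i\<in>F. a i *\<^sub>R x i)"
    using assms(6) unfolding ell1_spreading_model_def by blast
  obtain m :: "nat \<Rightarrow> nat" where m: "strict_mono m" "\<And>i. 1 \<le> m i"
    and off: "\<And>F N f. finite F \<Longrightarrow> f \<in> dual_ball_coords x \<Longrightarrow> (\<And>i. i \<in> F \<Longrightarrow> c \<le> f (m i)) \<Longrightarrow>
       \<exists>g\<in>dual_ball_coords x. (\<forall>i\<in>F. c \<le> g (m i)) \<and> (\<forall>i<N. i \<notin> F \<longrightarrow> \<bar>g (m i)\<bar> \<le> (1/2) ^ i)"
  \<comment> \<open>The weights \<open>(1/2) ^ i\<close> sum to less than 1 over positive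
    indices.\<close>
  proof (rule small_off_set_subsequence[of "dual_ball_coords x" "\<lambda>i. (1/2) ^ i" c])
    show "\<exists>J\<subseteq>L. finite J \<and> (\<forall>f\<in>dual_ball_coords x. \<exists>l\<in>J. \<bar>f l\<bar> \<le> e)" if "infinite L" "0 < e" for L e
      using assms(5,3) that by (rule dual_ball_coords_small)
  qed (simp, blast)
  have inj_m: "inj m"
    using m(1) by (rule strict_mono_imp_inj_on)
  \<comment> \<open>One factor \<open>?N\<close> bounds \<open>g\<close> on the whole sum, the other
    bounds its contribution off the positive part.\<close>
  have pos_part: "c * (\<Sum>i\<in>{i\<in>F. 0 < a i}. a i) \<le> 2 * norm (\<Sum>i\<in>{1..K}. a i *\<^sub>R x (m i))"
    if F: "schreier \<beta> xi F" and a: "\<forall>i>K. a i = 0" for F a K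
  proof -
    let ?N = "norm (\<Sum>i\<in>{1..K}. a i *\<^sub>R x (m i))"
    define G where "G = {i\<in>F. 0 < a i}"
    have fin: "finite F" "0 \<notin> F"
      using schreier_finite_pos[OF F] by auto
    have "finite G"
      using fin by (simp add: G_def)
    have "1 \<le> i \<and> i \<le> K" if "i \<in> G" for i
    proof -
      have "i \<in> F" "0 < a i" using that by (simp_all add: G_def)
      then have "i \<noteq> 0" using fin(2) by metis
      moreover have "\<not> K < i" using a \<open>0 < a i\<close> by auto
      ultimately show ?thesis by simp
    qed
    then have "G \<subseteq> {1..K}"
      by auto
    note G = \<open>finite G\<close> this
    have zero_notin: "0 \<notin> m ` A" for A
      using m(2) by (metis imageE not_one_le_zero)
    have "c * (\<Sum>i\<in>m ` G. b i) \<le> norm (\<Sum>i\<in>m ` G. b i *\<^sub>R x i)" if "\<And>i. 0 \<le> b i" for b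
    proof -
      have GF: "m ` G \<subseteq> m ` F" by (auto simp: G_def)
      \<comment> \<open>Zero extension from the image of \<open>G\<close> to that of
        \<open>F\<close> restricts the lower estimate without appeal to heredity of the
        family.\<close>
      let ?b = "\<lambda>i. if i \<in> m ` G then b i else 0"
      have "(\<Sum>i\<in>m ` F. \<bar>?b i\<bar>) = (\<Sum>i\<in>m ` G. b i)" "(\<Sum>i\<in>m ` F. ?b i *\<^sub>R x i) = (\<Sum>i\<in>m ` G. b i *\<^sub>R x i)"
        using fin that GF by (auto intro!: sum.mono_neutral_cong_right)
      with ell1[OF schreier_spreading[OF F m(1)], of ?b] show ?thesis by simp
    qed
    from dual_ball_coords_positive[OF finite_imageI[OF G(1)] zero_notin this]
    obtain f where f: "f \<in> dual_ball_coords x" "\<And>i. i \<in> m ` G \<Longrightarrow> c \<le> f i"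
      by auto
    \<comment> \<open>\<open>Suc K\<close> makes the strict bound in \<open>off\<close> reach index
      \<open>K\<close>.\<close>
    obtain g where g: "g \<in> dual_ball_coords x" "\<And>i. i \<in> G \<Longrightarrow> c \<le> g (m i)"
      "\<And>i. i < Suc K \<Longrightarrow> i \<notin> G \<Longrightarrow> \<bar>g (m i)\<bar> \<le> (1/2) ^ i"
      using off[OF G(1) f(1), of "Suc K"] f(2) by blast
    note sum_x = sum_image_the_inv[OF inj_m, of "\<lambda>j i. a j *\<^sub>R x i" "{1..K}"]
    note sum_g = sum_image_the_inv[OF inj_m, of "\<lambda>j i. a j * g i" "{1..K}"]
    have coeff: "\<bar>a i\<bar> \<le> ?N" if "i \<in> {1..K}" for i
    proof -
      have "\<bar>a (the_inv m (m i))\<bar> \<le> norm (\<Sum>i\<in>m ` {1..K}. a (the_inv m i) *\<^sub>R x i)"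
        using that by (intro bimonotone_coeff_bound[OF assms(4,3) _ zero_notin]) auto
      then show ?thesis
        unfolding sum_x the_inv_f_f[OF inj_m] .
    qed
    have "\<bar>\<Sum>i\<in>m ` {1..K}. a (the_inv m i) * g i\<bar> \<le> norm (\<Sum>i\<in>m ` {1..K}. a (the_inv m i) *\<^sub>R x i)"
      using dual_ball_coordsD[OF g(1) finite_imageI[OF finite_atLeastAtMost] zero_notin] .
    then have "(\<Sum>i\<in>{1..K}. a i * g (m i)) \<le> ?N"
      unfolding sum_x sum_g by simp
    moreover have "(\<Sum>i\<in>{1..K}. a i * g (m i)) = (\<Sum>i\<in>G. a i * g (m i)) + (\<Sum>i\<in>{1..K} - G. a i * g (m i))"
      using sum.subset_diff[OF G(2) finite_atLeastAtMost, of "\<lambda>i. a i * g (m i)"] by simp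
    moreover have "c * (\<Sum>i\<in>G. a i) \<le> (\<Sum>i\<in>G. a i * g (m i))"
      unfolding sum_distrib_left
    proof (rule sum_mono)
      fix i assume "i \<in> G"
      then have "a i * c \<le> a i * g (m i)"
        by (intro mult_left_mono g(2)) (simp_all add: G_def)
      then show "c * a i \<le> a i * g (m i)"
        by (simp add: mult.commute)
    qed
    \<comment> \<open>Coefficients are at most \<open>?N\<close>, so the remainder is dominated by a
      geometric series.\<close>
    moreover have "\<bar>\<Sum>i\<in>{1..K} - G. a i * g (m i)\<bar> \<le> ?N"
    proof -
      have "\<bar>\<Sum>i\<in>{1..K} - G. a i * g (m i)\<bar> \<le> (\<Sum>i\<in>{1..K} - G. \<bar>a i * g (m i)\<bar>)"
        by (rule sum_abs)
      also have "\<dots> \<le> (\<Sum>i\<in>{1..K} - G. ?N * (1/2) ^ i)"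
        unfolding abs_mult using coeff g(3) by (intro sum_mono mult_mono) auto
      also have "\<dots> \<le> (\<Sum>i\<in>{1..K}. ?N * (1/2) ^ i)"
        by (intro sum_mono2) auto
      also have "\<dots> = ?N * (\<Sum>i\<in>{1..K}. (1/2) ^ i)"
        by (simp add: sum_distrib_left)
      also have "(\<Sum>i\<in>{1..K}. (1/2) ^ i) = 1 - (1/2 :: real) ^ K"
        by (induction K) (auto simp: atLeastAtMostSuc_conv)
      also have "?N * (1 - (1/2) ^ K) \<le> ?N * 1"
        by (intro mult_left_mono) auto
      finally show ?thesis by simp
    qed
    ultimately show ?thesis
      unfolding G_def[symmetric] by linarith
  qed
  \<comment> \<open>The constant \<open>4 / c\<close> is \<open>2 / c\<close> from the positive part
    plus \<open>2 / c\<close> from the negative part, the latter by applying \<open>pos_part\<close>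
    to \<open>- a\<close>.\<close>
  have "norm (\<Sum>i\<in>F. a i *\<^sub>R x (m i)) \<le> 4 / c * norm (\<Sum>i\<in>{1..K}. a i *\<^sub>R x (m i))"
    if F: "schreier \<beta> xi F" and a: "\<forall>i>K. a i = 0" for F a K
  proof -
    let ?N = "norm (\<Sum>i\<in>{1..K}. a i *\<^sub>R x (m i))"
    have fin: "finite F"
      using schreier_finite_pos[OF F] by auto
    have "norm (\<Sum>i\<in>F. a i *\<^sub>R x (m i)) \<le> (\<Sum>i\<in>F. \<bar>a i\<bar>)"
      using assms(3) m(2) by (intro sum_norm_le) (simp add: normalized_seq_def)
    also have "\<dots> = (\<Sum>i\<in>F. (if 0 < a i then a i else 0) + (if 0 < - a i then - a i else 0))"
      by (intro sum.cong) auto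
    also have "\<dots> = (\<Sum>i\<in>{i\<in>F. 0 < a i}. a i) + (\<Sum>i\<in>{i\<in>F. 0 < - a i}. - a i)"
      using fin by (simp only: sum.distrib sum.inter_filter)
    also have "\<dots> \<le> 4 / c * ?N"
      using pos_part[OF F a] pos_part[OF F, of K "\<lambda>i. - a i"] a c
      by (simp add: sum_negf field_simps)
    finally show ?thesis .
  qed
  then have "S_unconditional (schreier \<beta> xi) (x \<circ> m)"
    unfolding S_unconditional_def using c by (intro exI[of _ "4 / c"]) auto
  with m show ?thesis by blast
qed

end
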